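(* Let $\Omega$ be a nonempty set and $\mathbf{k}$ a field. (1) Let $A$ be a commutative associative $\mathbf{k}$-algebra with a family of pairwise commuting derivations $\partial_\omega$, $\omega\in\Omega$. Define $x\rhd_\omega y:=x\,\partial_\omega(y)$ for $x,y\in A$, $\omega\in\Omega$. Then $(A,\{\rhd_\omega\}_{\omega\in\Omega})$ is a multi-Novikov algebra. (2) Let $A$ be a commutative associative $\mathbf{k}$-algebra with a family of (not necessarily pairwise commuting) derivations $\partial_\omega$, $\omega\in\Omega$. Define $x\rhd_\omega y:=x\,\partial_\omega(y)$ for $x,y\in A$, $\omega\in\Omega$. Then $(A,\{\rhd_\omega\}_{\omega\in\Omega})$ is a noncommuting multi-Novikov algebra. (3) Let $A$ be a (not necessarily commutative) associative $\mathbf{k}$-algebra with a family of pairwise commuting derivations $\partial_\omega$, $\omega\in\Omega$. Define $x\rhd_\omega y:=x\,\partial_\omega(y)$ and $x\lhd_\omega y:=\partial_\omega(x)\,y$ for $x,y\in A$, $\omega\in\Omega$. Then $(A,\{\rhd_\omega\}_{\omega\in\Omega},\{\lhd_\omega\}_{\omega\in\Omega})$ is a multi-noncommutative Novikov algebra. (4) Let $A$ be a (not necessarily commutative) associative $\mathbf{k}$-algebra with a family of (not necessarily pairwise commuting) derivations $\partial_\omega$, $\omega\in\Omega$. Define $x\rhd_\omega y:=x\,\partial_\omega(y)$ and $x\lhd_\omega y:=\partial_\omega(x)\,y$ for $x,y\in A$, $\omega\in\Omega$. Then $(A,\{\rhd_\omega\}_{\omega\in\Omega},\{\lhd_\omega\}_{\omega\in\Omega})$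 is a noncommuting multi-noncommutative Novikov algebra.
   Context: A derivation on an algebra $A$ is a linear map $d:A\to A$ with $d(xy)=d(x)y+x\,d(y)$. A *multi-Novikov algebra* is a vector space $N$ with bilinear products $\rhd_\omega$, $\omega\in\Omega$, such that for all $x,y,z\in N$, $\omega,\tau\in\Omega$: - $(x\rhd_\omega y)\rhd_\tau z-x\rhd_\omega(y\rhd_\tau z)=(y\rhd_\omega x)\rhd_\tau z-y\rhd_\omega(x\rhd_\tau z)$, - $(x\rhd_\omega y)\rhd_\tau z-x\rhd_\omega(y\rhd_\tau z)=(x\rhd_\tau y)\rhd_\omega z-x\rhd_\tau(y\rhd_\omega z)$, - $(x\rhd_\omega y)\rhd_\tau z=(x\rhd_\tau z)\rhd_\omega y$. A *noncommuting multi-Novikov algebra* is a vector space $N$ with bilinear products $\rhd_\omega$, $\omega\in\Omega$, such that for all $x,y,z\in N$, $\omega,\tau\in\Omega$: - $(x\rhd_\omega y)\rhd_\tau z-x\rhd_\omega(y\rhd_\tau z)=(y\rhd_\omega x)\rhd_\tau z-y\rhd_\omega(x\rhd_\tau z)$, - $(x\rhd_\omega y)\rhd_\tau z=(x\rhd_\tau z)\rhd_\omega y$. A *multi-noncommutative Novikov algebra* is a vector space $N$ with two families of bilinear products $\rhd_\omega,\lhd_\omega$, $\omega\in\Omega$, such that for all $x,y,z\in N$, $\omega,\tau\in\Omega$: - $(x\lhd_\omega y)\rhd_\tau z=x\lhd_\omega(y\rhd_\tau z)$, - $(x\rhd_\omega y)\rhd_\tau z-x\lhd_\tau(y\lhd_\omega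 z)=x\rhd_\tau(y\lhd_\omega z)-(x\rhd_\omega y)\lhd_\tau z$, - $x\rhd_\omega(y\rhd_\tau z)-x\rhd_\tau(y\rhd_\omega z)=x\rhd_\tau(y\lhd_\omega z)-x\rhd_\omega(y\lhd_\tau z)$, - $(x\rhd_\tau y)\rhd_\omega z-x\lhd_\tau(y\lhd_\omega z)=x\rhd_\omega(y\lhd_\tau z)-(x\rhd_\omega y)\lhd_\tau z$, - $(x\lhd_\omega y)\lhd_\tau z-(x\lhd_\tau y)\lhd_\omega z=(x\rhd_\tau y)\lhd_\omega z-(x\rhd_\omega y)\lhd_\tau z$, - $x\lhd_\omega(y\lhd_\tau z)-x\lhd_\tau(y\lhd_\omega z)=(x\rhd_\tau y)\lhd_\omega z-(x\rhd_\omega y)\lhd_\tau z$. A *noncommuting multi-noncommutative Novikov algebra* is a vector space $N$ with two families of bilinear products $\rhd_\omega,\lhd_\omega$, $\omega\in\Omega$, such that for all $x,y,z\in N$, $\omega,\tau\in\Omega$: - $(x\lhd_\omega y)\rhd_\tau z=x\lhd_\omega(y\rhd_\tau z)$, - $(x\rhd_\omega y)\rhd_\tau z-x\lhd_\tau(y\lhd_\omega z)=x\rhd_\tau(y\lhd_\omega z)-(x\rhd_\omega y)\lhd_\tau z$. *)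

theory Defs
  imports Complex_Main
begin

definition bilinear_product ::
    "('k::field \<Rightarrow> 'a::ab_group_add \<Rightarrow> 'a) \<Rightarrow> ('a \<Rightarrow> 'a \<Rightarrow> 'a) \<Rightarrow> bool" where
  "bilinear_product scale p \<longleftrightarrow>
     (\<forall>x. Vector_Spaces.linear scale scale (\<lambda>y. p x y)) \<and>
     (\<forall>y. Vector_Spaces.linear scale scale (\<lambda>x. p x y))"

text \<open>
  The class \<open>ring\<close> supplies an associative, distributive multiplication and asks neither for a
  unit nor for commutativity; commutative algebras are those over a type of class \<open>comm_ring\<close>.
\<close>

locale assoc_algebra = vector_space scale
  for scale :: "'k::field \<Rightarrow> 'a::ring \<Rightarrow> 'a" +
  assumes mult_bilinear: "bilinear_product scale (*)"

definition derivation :: "('k::field \<Rightarrow> 'a::ring \<Rightarrow> 'a) \<Rightarrow> ('a \<Rightarrow> 'a) \<Rightarrow> bool" where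
  "derivation scale d \<longleftrightarrow>
     Vector_Spaces.linear scale scale d \<and> (\<forall>x y. d (x * y) = d x * y + x * d y)"

definition pairwise_commuting :: "'w set \<Rightarrow> ('w \<Rightarrow> 'a \<Rightarrow> 'a) \<Rightarrow> bool" where
  "pairwise_commuting \<Omega> d \<longleftrightarrow> (\<forall>\<omega>\<in>\<Omega>. \<forall>\<tau>\<in>\<Omega>. d \<omega> \<circ> d \<tau> = d \<tau> \<circ> d \<omega>)"

text \<open>
  The index is the middle argument of a product, so that \<open>x \<rhd>\<^bsub>\<omega>\<^esub> y\<close> is \<open>rhd x \<omega> y\<close>.  Only the
  products with index in \<open>\<Omega>\<close> are constrained.
\<close>

locale multi_novikov_algebra = vector_space scale
  for scale :: "'k::field \<Rightarrow> 'a::ab_group_add \<Rightarrow> 'a" +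
  fixes \<Omega> :: "'w set"
    and rhd :: "'a \<Rightarrow> 'w \<Rightarrow> 'a \<Rightarrow> 'a"  (\<open>(_ \<rhd>\<^bsub>_\<^esub> _)\<close> [71, 0, 71] 70)
  assumes rhd_bilinear: "\<omega> \<in> \<Omega> \<Longrightarrow> bilinear_product scale (\<lambda>x y. x \<rhd>\<^bsub>\<omega>\<^esub> y)"
    and left_symmetric: "\<lbrakk>\<omega> \<in> \<Omega>; \<tau> \<in> \<Omega>\<rbrakk> \<Longrightarrow>
      (x \<rhd>\<^bsub>\<omega>\<^esub> y) \<rhd>\<^bsub>\<tau>\<^esub> z - x \<rhd>\<^bsub>\<omega>\<^esub> (y \<rhd>\<^bsub>\<tau>\<^esub> z) = (y \<rhd>\<^bsub>\<omega>\<^esub> x) \<rhd>\<^bsub>\<tau>\<^esub> z - y \<rhd>\<^bsub>\<omega>\<^esub> (x \<rhd>\<^bsub>\<tau>\<^esub> z)"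
    and index_symmetric: "\<lbrakk>\<omega> \<in> \<Omega>; \<tau> \<in> \<Omega>\<rbrakk> \<Longrightarrow>
      (x \<rhd>\<^bsub>\<omega>\<^esub> y) \<rhd>\<^bsub>\<tau>\<^esub> z - x \<rhd>\<^bsub>\<omega>\<^esub> (y \<rhd>\<^bsub>\<tau>\<^esub> z) = (x \<rhd>\<^bsub>\<tau>\<^esub> y) \<rhd>\<^bsub>\<omega>\<^esub> z - x \<rhd>\<^bsub>\<tau>\<^esub> (y \<rhd>\<^bsub>\<omega>\<^esub> z)"
    and right_commutative: "\<lbrakk>\<omega> \<in> \<Omega>; \<tau> \<in> \<Omega>\<rbrakk> \<Longrightarrow>
      (x \<rhd>\<^bsub>\<omega>\<^esub> y) \<rhd>\<^bsub>\<tau>\<^esub> z = (x \<rhd>\<^bsub>\<tau>\<^esub> z) \<rhd>\<^bsub>\<omega>\<^esub> y"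

locale noncommuting_multi_novikov_algebra = vector_space scale
  for scale :: "'k::field \<Rightarrow> 'a::ab_group_add \<Rightarrow> 'a" +
  fixes \<Omega> :: "'w set"
    and rhd :: "'a \<Rightarrow> 'w \<Rightarrow> 'a \<Rightarrow> 'a"  (\<open>(_ \<rhd>\<^bsub>_\<^esub> _)\<close> [71, 0, 71] 70)
  assumes rhd_bilinear: "\<omega> \<in> \<Omega> \<Longrightarrow> bilinear_product scale (\<lambda>x y. x \<rhd>\<^bsub>\<omega>\<^esub> y)"
    and left_symmetric: "\<lbrakk>\<omega> \<in> \<Omega>; \<tau> \<in> \<Omega>\<rbrakk> \<Longrightarrow>
      (x \<rhd>\<^bsub>\<omega>\<^esub> y) \<rhd>\<^bsub>\<tau>\<^esub> z - x \<rhd>\<^bsub>\<omega>\<^esub> (y \<rhd>\<^bsub>\<tau>\<^esub> z) = (y \<rhd>\<^bsub>\<omega>\<^esub> x) \<rhd>\<^bsub>\<tau>\<^esub> z - y \<rhd>\<^bsub>\<omega>\<^esub> (x \<rhd>\<^bsub>\<tau>\<^esub> z)"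
    and right_commutative: "\<lbrakk>\<omega> \<in> \<Omega>; \<tau> \<in> \<Omega>\<rbrakk> \<Longrightarrow>
      (x \<rhd>\<^bsub>\<omega>\<^esub> y) \<rhd>\<^bsub>\<tau>\<^esub> z = (x \<rhd>\<^bsub>\<tau>\<^esub> z) \<rhd>\<^bsub>\<omega>\<^esub> y"

locale multi_noncommutative_novikov_algebra = vector_space scale
  for scale :: "'k::field \<Rightarrow> 'a::ab_group_add \<Rightarrow> 'a" +
  fixes \<Omega> :: "'w set"
    and rhd :: "'a \<Rightarrow> 'w \<Rightarrow> 'a \<Rightarrow> 'a"  (\<open>(_ \<rhd>\<^bsub>_\<^esub> _)\<close> [71, 0, 71] 70)
    and lhd :: "'a \<Rightarrow> 'w \<Rightarrow> 'a \<Rightarrow> 'a"  (\<open>(_ \<lhd>\<^bsub>_\<^esub> _)\<close> [71, 0, 71] 70)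
  assumes rhd_bilinear: "\<omega> \<in> \<Omega> \<Longrightarrow> bilinear_product scale (\<lambda>x y. x \<rhd>\<^bsub>\<omega>\<^esub> y)"
    and lhd_bilinear: "\<omega> \<in> \<Omega> \<Longrightarrow> bilinear_product scale (\<lambda>x y. x \<lhd>\<^bsub>\<omega>\<^esub> y)"
    and lhd_rhd_assoc: "\<lbrakk>\<omega> \<in> \<Omega>; \<tau> \<in> \<Omega>\<rbrakk> \<Longrightarrow>
      (x \<lhd>\<^bsub>\<omega>\<^esub> y) \<rhd>\<^bsub>\<tau>\<^esub> z = x \<lhd>\<^bsub>\<omega>\<^esub> (y \<rhd>\<^bsub>\<tau>\<^esub> z)"
    and mixed: "\<lbrakk>\<omega> \<in> \<Omega>; \<tau> \<in> \<Omega>\<rbrakk> \<Longrightarrow>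
      (x \<rhd>\<^bsub>\<omega>\<^esub> y) \<rhd>\<^bsub>\<tau>\<^esub> z - x \<lhd>\<^bsub>\<tau>\<^esub> (y \<lhd>\<^bsub>\<omega>\<^esub> z) = x \<rhd>\<^bsub>\<tau>\<^esub> (y \<lhd>\<^bsub>\<omega>\<^esub> z) - (x \<rhd>\<^bsub>\<omega>\<^esub> y) \<lhd>\<^bsub>\<tau>\<^esub> z"
    and rhd_exchange: "\<lbrakk>\<omega> \<in> \<Omega>; \<tau> \<in> \<Omega>\<rbrakk> \<Longrightarrow>
      x \<rhd>\<^bsub>\<omega>\<^esub> (y \<rhd>\<^bsub>\<tau>\<^esub> z) - x \<rhd>\<^bsub>\<tau>\<^esub> (y \<rhd>\<^bsub>\<omega>\<^esub> z) = x \<rhd>\<^bsub>\<tau>\<^esub> (y \<lhd>\<^bsub>\<omega>\<^esub> z) - x \<rhd>\<^bsub>\<omega>\<^esub> (y \<lhd>\<^bsub>\<tau>\<^esub> z)"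
    and mixed_exchange: "\<lbrakk>\<omega> \<in> \<Omega>; \<tau> \<in> \<Omega>\<rbrakk> \<Longrightarrow>
      (x \<rhd>\<^bsub>\<tau>\<^esub> y) \<rhd>\<^bsub>\<omega>\<^esub> z - x \<lhd>\<^bsub>\<tau>\<^esub> (y \<lhd>\<^bsub>\<omega>\<^esub> z) = x \<rhd>\<^bsub>\<omega>\<^esub> (y \<lhd>\<^bsub>\<tau>\<^esub> z) - (x \<rhd>\<^bsub>\<omega>\<^esub> y) \<lhd>\<^bsub>\<tau>\<^esub> z"
    and lhd_exchange_left: "\<lbrakk>\<omega> \<in> \<Omega>; \<tau> \<in> \<Omega>\<rbrakk> \<Longrightarrow>
      (x \<lhd>\<^bsub>\<omega>\<^esub> y) \<lhd>\<^bsub>\<tau>\<^esub> z - (x \<lhd>\<^bsub>\<tau>\<^esub> y) \<lhd>\<^bsub>\<omega>\<^esub> z = (x \<rhd>\<^bsub>\<tau>\<^esub> y) \<lhd>\<^bsub>\<omega>\<^esub> z - (x \<rhd>\<^bsub>\<omega>\<^esub> y) \<lhd>\<^bsub>\<tau>\<^esub> z"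
    and lhd_exchange_right: "\<lbrakk>\<omega> \<in> \<Omega>; \<tau> \<in> \<Omega>\<rbrakk> \<Longrightarrow>
      x \<lhd>\<^bsub>\<omega>\<^esub> (y \<lhd>\<^bsub>\<tau>\<^esub> z) - x \<lhd>\<^bsub>\<tau>\<^esub> (y \<lhd>\<^bsub>\<omega>\<^esub> z) = (x \<rhd>\<^bsub>\<tau>\<^esub> y) \<lhd>\<^bsub>\<omega>\<^esub> z - (x \<rhd>\<^bsub>\<omega>\<^esub> y) \<lhd>\<^bsub>\<tau>\<^esub> z"

locale noncommuting_multi_noncommutative_novikov_algebra = vector_space scale
  for scale :: "'k::field \<Rightarrow> 'a::ab_group_add \<Rightarrow> 'a" +
  fixes \<Omega> :: "'w set"
    and rhd :: "'a \<Rightarrow> 'w \<Rightarrow> 'a \<Rightarrow> 'a"  (\<open>(_ \<rhd>\<^bsub>_\<^esub> _)\<close> [71, 0, 71] 70)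
    and lhd :: "'a \<Rightarrow> 'w \<Rightarrow> 'a \<Rightarrow> 'a"  (\<open>(_ \<lhd>\<^bsub>_\<^esub> _)\<close> [71, 0, 71] 70)
  assumes rhd_bilinear: "\<omega> \<in> \<Omega> \<Longrightarrow> bilinear_product scale (\<lambda>x y. x \<rhd>\<^bsub>\<omega>\<^esub> y)"
    and lhd_bilinear: "\<omega> \<in> \<Omega> \<Longrightarrow> bilinear_product scale (\<lambda>x y. x \<lhd>\<^bsub>\<omega>\<^esub> y)"
    and lhd_rhd_assoc: "\<lbrakk>\<omega> \<in> \<Omega>; \<tau> \<in> \<Omega>\<rbrakk> \<Longrightarrow>
      (x \<lhd>\<^bsub>\<omega>\<^esub> y) \<rhd>\<^bsub>\<tau>\<^esub> z = x \<lhd>\<^bsub>\<omega>\<^esub> (y \<rhd>\<^bsub>\<tau>\<^esub> z)"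
    and mixed: "\<lbrakk>\<omega> \<in> \<Omega>; \<tau> \<in> \<Omega>\<rbrakk> \<Longrightarrow>
      (x \<rhd>\<^bsub>\<omega>\<^esub> y) \<rhd>\<^bsub>\<tau>\<^esub> z - x \<lhd>\<^bsub>\<tau>\<^esub> (y \<lhd>\<^bsub>\<omega>\<^esub> z) = x \<rhd>\<^bsub>\<tau>\<^esub> (y \<lhd>\<^bsub>\<omega>\<^esub> z) - (x \<rhd>\<^bsub>\<omega>\<^esub> y) \<lhd>\<^bsub>\<tau>\<^esub> z"

end

theory Submission
  imports Defs
begin

text \<open>Each product is the multiplication of \<open>A\<close> with a derivation inserted in one
  argument, so bilinearity is inherited by composing with a linear map. For the identities, every
  derivation is applied to a single product, so the Leibniz rule turns both sides into signed sums
  of monomials in \<open>x\<close>, \<open>y\<close>, \<open>z\<close> and their derivatives, and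
  these are compared. Reordering factors uses commutativity of \<open>A\<close>; exchanging
  \<open>d \<omega> (d \<tau> u)\<close> with \<open>d \<tau> (d \<omega> u)\<close> uses commuting
  derivations.\<close>

lemma bilinear_product_compose_right:
  assumes "bilinear_product scale p" "Vector_Spaces.linear scale scale f"
  shows "bilinear_product scale (\<lambda>x y. p x (f y))"
  using assms Vector_Spaces.linear_compose[OF assms(2)]
  by (auto simp: bilinear_product_def o_def)

lemma bilinear_product_compose_left:
  assumes "bilinear_product scale p" "Vector_Spaces.linear scale scale f"
  shows "bilinear_product scale (\<lambda>x y. p (f x) y)"
  using assms Vector_Spaces.linear_compose[OF assms(2)]
  by (auto simp: bilinear_product_def o_def)

lemma derivation_mult: "derivation scale d \<Longrightarrow> d (x * y) = d x * y + x * d y"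
  by (simp add: derivation_def)

text \<open>The pointwise form serves as a permutative rewrite rule: iterated derivatives are
  brought into one order, so that equal monomials become syntactically equal.\<close>

lemma pairwise_commutingD:
  "pairwise_commuting \<Omega> d \<Longrightarrow> \<omega> \<in> \<Omega> \<Longrightarrow> \<tau> \<in> \<Omega> \<Longrightarrow> d \<omega> (d \<tau> x) = d \<tau> (d \<omega> x)"
  unfolding pairwise_commuting_def by (metis comp_apply)

context assoc_algebra
begin

lemma bilinear_mult_derivation: "derivation scale d \<Longrightarrow> bilinear_product scale (\<lambda>x y. x * d y)"
  using bilinear_product_compose_right[OF mult_bilinear] by (simp add: derivation_def)

lemma bilinear_derivation_mult: "derivation scale d \<Longrightarrow> bilinear_product scale (\<lambda>x y. d x * y)"
  using bilinear_product_compose_left[OF mult_bilinear] by (simp add: derivation_def)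

text \<open>The first identity is associativity. In the mixed one, both terms on the right produce
  \<open>x * d \<tau> (d \<omega> y) * z\<close>, with the same order of derivations, and these
  cancel.\<close>

lemma noncommuting_multi_noncommutative_novikov:
  assumes "\<And>\<omega>. \<omega> \<in> \<Omega> \<Longrightarrow> derivation scale (d \<omega>)"
  shows "noncommuting_multi_noncommutative_novikov_algebra scale \<Omega>
    (\<lambda>x \<omega> y. x * d \<omega> y) (\<lambda>x \<omega> y. d \<omega> x * y)"
  by unfold_locales
    (simp_all add: assms bilinear_mult_derivation bilinear_derivation_mult
      derivation_mult[OF assms] algebra_simps)

text \<open>In the four exchange identities the second-order terms occur with both orders of
  \<open>\<omega>\<close> and \<open>\<tau>\<close>; they cancel or match once the derivations
  commute.\<close>

lemma multi_noncommutative_novikov: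
  assumes "\<And>\<omega>. \<omega> \<in> \<Omega> \<Longrightarrow> derivation scale (d \<omega>)" and "pairwise_commuting \<Omega> d"
  shows "multi_noncommutative_novikov_algebra scale \<Omega>
    (\<lambda>x \<omega> y. x * d \<omega> y) (\<lambda>x \<omega> y. d \<omega> x * y)"
  by unfold_locales
    (simp_all add: assms(1) bilinear_mult_derivation bilinear_derivation_mult
      derivation_mult[OF assms(1)] pairwise_commutingD[OF assms(2)] algebra_simps)

end

text \<open>The associator is \<open>- (x * y * d \<omega> (d \<tau> z))\<close>, symmetric in
  \<open>x\<close> and \<open>y\<close> when \<open>A\<close> is commutative. The statement stands
  outside the locale so that the carrier can be narrowed to \<open>comm_ring\<close>.\<close>

lemma noncommuting_multi_novikov:
  fixes scale :: "'k::field \<Rightarrow> 'a::comm_ring \<Rightarrow> 'a"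
  assumes "assoc_algebra scale" and "\<And>\<omega>. \<omega> \<in> \<Omega> \<Longrightarrow> derivation scale (d \<omega>)"
  shows "noncommuting_multi_novikov_algebra scale \<Omega> (\<lambda>x \<omega> y. x * d \<omega> y)"
proof -
  interpret assoc_algebra scale by fact
  show ?thesis
    by unfold_locales
      (simp_all add: assms(2) bilinear_mult_derivation derivation_mult[OF assms(2)] algebra_simps)
qed

text \<open>Commuting derivations make the same associator symmetric in \<open>\<omega>\<close> and
  \<open>\<tau>\<close> as well, which is the additional axiom.\<close>

lemma multi_novikov:
  fixes scale :: "'k::field \<Rightarrow> 'a::comm_ring \<Rightarrow> 'a"
  assumes "assoc_algebra scale" and "\<And>\<omega>. \<omega> \<in> \<Omega> \<Longrightarrow> derivation scale (d \<omega>)"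
    and "pairwise_commuting \<Omega> d"
  shows "multi_novikov_algebra scale \<Omega> (\<lambda>x \<omega> y. x * d \<omega> y)"
proof -
  interpret assoc_algebra scale by fact
  show ?thesis
    by unfold_locales
      (simp_all add: assms(2) bilinear_mult_derivation derivation_mult[OF assms(2)]
        pairwise_commutingD[OF assms(3)] algebra_simps)
qed

theorem theorem3p2:
  fixes \<Omega> :: "'w set"
  assumes "\<Omega> \<noteq> {}"
  shows
    "(\<forall>(scale :: 'k::field \<Rightarrow> 'a::comm_ring \<Rightarrow> 'a) (d :: 'w \<Rightarrow> 'a \<Rightarrow> 'a).
        assoc_algebra scale \<and> (\<forall>\<omega>\<in>\<Omega>. derivation scale (d \<omega>)) \<and> pairwise_commuting \<Omega> d \<longrightarrow>
        multi_novikov_algebra scale \<Omega> (\<lambda>x \<omega> y. x * d \<omega> y)) \<and>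
     (\<forall>(scale :: 'k \<Rightarrow> 'a \<Rightarrow> 'a) (d :: 'w \<Rightarrow> 'a \<Rightarrow> 'a).
        assoc_algebra scale \<and> (\<forall>\<omega>\<in>\<Omega>. derivation scale (d \<omega>)) \<longrightarrow>
        noncommuting_multi_novikov_algebra scale \<Omega> (\<lambda>x \<omega> y. x * d \<omega> y)) \<and>
     (\<forall>(scale :: 'k \<Rightarrow> 'b::ring \<Rightarrow> 'b) (d :: 'w \<Rightarrow> 'b \<Rightarrow> 'b).
        assoc_algebra scale \<and> (\<forall>\<omega>\<in>\<Omega>. derivation scale (d \<omega>)) \<and> pairwise_commuting \<Omega> d \<longrightarrow>
        multi_noncommutative_novikov_algebra scale \<Omega>
          (\<lambda>x \<omega> y. x * d \<omega> y) (\<lambda>x \<omega> y. d \<omega> x * y)) \<and>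
     (\<forall>(scale :: 'k \<Rightarrow> 'b \<Rightarrow> 'b) (d :: 'w \<Rightarrow> 'b \<Rightarrow> 'b).
        assoc_algebra scale \<and> (\<forall>\<omega>\<in>\<Omega>. derivation scale (d \<omega>)) \<longrightarrow>
        noncommuting_multi_noncommutative_novikov_algebra scale \<Omega>
          (\<lambda>x \<omega> y. x * d \<omega> y) (\<lambda>x \<omega> y. d \<omega> x * y))"
  by (simp add: multi_novikov noncommuting_multi_novikov
      assoc_algebra.multi_noncommutative_novikov
      assoc_algebra.noncommuting_multi_noncommutative_novikov)

end
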